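(* Let $(K,\Sigma)$ be a loose FFCC pair for $\mathbf H$ and $\bar t\in\mathrm{PC}_\infty(K,\Sigma)$. Let $D\in\mathrm{uf}^1_{\bar t}(K,\Sigma)$ satisfy $D\oplus D=D$. Then for every $A\in D$ there is $\bar s\in\mathrm{PC}_\infty(K,\Sigma)$ with $\bar s\ge\bar t$ and $\mathrm{pos}(\bar s)\subseteq A$.
   Context: Notation: an integer $n$ is identified with $\{0,\dots,n-1\}$; $[n,m)=\{k\in\omega:n\le k<m\}$. Fix a function $\mathbf{H}$ with domain $\omega$ such that each $\mathbf{H}(i)$ is a finite non-empty set; $\mathcal{F}_{\mathbf H}$ is the set of all finite non-empty functions $f$ with $\mathrm{dom}(f)\subseteq\omega$ and $f(i)\in\mathbf H(i)$ for $i\in\mathrm{dom}(f)$. An FP creature for $\mathbf H$ is a tuple $t=(\mathrm{nor}[t],\mathrm{val}[t],\mathrm{dis}[t],m^t_{\mathrm{dn}},m^t_{\mathrm{up}})$ with $\mathrm{nor}[t]\ge0$ real, $\mathrm{dis}[t]$ arbitrary, $m^t_{\mathrm{dn}}<m^t_{\mathrm{up}}<\omega$, $\mathrm{val}[t]$ a non-empty finite subset of $\mathcal F_{\mathbf H}$ whose members have domain inside $[m^t_{\mathrm{dn}},m^t_{\mathrm{up}})$. An FFCC pair for $\mathbf H$ is $(K,\Sigma)$ such that: (a) $K$ is a countable family of FP creatures for $\mathbf H$; (b) for each $m$, $\{t\in K:m^t_{\mathrm{up}}\le m\}$ is finite and $\{t\in K:m^t_{\mathrm{dn}}\ge m,\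 \mathrm{nor}[t]\ge m\}$ is infinite; (c) $\Sigma$ is a function defined on some finite sequences $(t_0,\dots,t_n)$ of members of $K$ with $m^{t_\ell}_{\mathrm{up}}\le m^{t_{\ell+1}}_{\mathrm{dn}}$ for $\ell<n$, with values non-empty subsets of $K$; (d) if $t\in\Sigma(t_0,\dots,t_n)$ then $m^t_{\mathrm{dn}}=m^{t_0}_{\mathrm{dn}}$, $m^t_{\mathrm{up}}=m^{t_n}_{\mathrm{up}}$; (e) $t\in\Sigma(t)$ for $t\in K$; (f) if $t\in\Sigma(t_0,\dots,t_n)$ and $f\in\mathrm{val}[t]$ then $\mathrm{dom}(f)\subseteq\bigcup_{\ell\le n}[m^{t_\ell}_{\mathrm{dn}},m^{t_\ell}_{\mathrm{up}})$ and $f\upharpoonright[m^{t_\ell}_{\mathrm{dn}},m^{t_\ell}_{\mathrm{up}})\in\mathrm{val}[t_\ell]\cup\{\emptyset\}$ for $\ell\le n$; (g) if $\bar t_0,\dots,\bar t_n\in\mathrm{dom}(\Sigma)$ and their concatenation $\bar t\in\mathrm{dom}(\Sigma)$ then $\Sigma(s_0,\dots,s_n)\subseteq\Sigma(\bar t)$ whenever $s_\ell\in\Sigma(\bar t_\ell)$. Outside $\mathrm{dom}(\Sigma)$, $\Sigma(\cdot)=\emptyset$. The pair is loose if $\mathrm{dom}(\Sigma)$ is the set of all finite sequences $(t_0,\dots,t_n)$ from $K$ with $m^{t_\ell}_{\mathrm{up}}\le m^{t_{\ell+1}}_{\mathrm{dn}}$ for $\ell<n$. $\mathrm{PC}_\infty(K,\Sigma)$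 is the set of sequences $\bar t=\langle t_n:n<\omega\rangle$ of members of $K$ with $m^{t_n}_{\mathrm{up}}\le m^{t_{n+1}}_{\mathrm{dn}}$ and $\lim_n\mathrm{nor}[t_n]=\infty$. $\bar t\le\bar s$ means there are non-empty finite $u_n\subseteq\omega$ with $\max u_n<\min u_{n+1}$ and $s_n\in\Sigma(\bar t\upharpoonright u_n)$ ($\bar t\upharpoonright u$ = the tuple $(t_i:i\in u)$ increasingly). $\bar t\upharpoonleft n=\langle t_{n+k}:k<\omega\rangle$; $\Sigma'(\bar t)=\bigcup\{\Sigma(t_{i_0},\dots,t_{i_k}):i_0<\dots<i_k<\omega\}$; $\mathrm{pos}(\bar t)=\bigcup\{\mathrm{val}[s]:s\in\Sigma'(\bar t)\}$. $\mathcal A^0_{\bar t}=\{\mathrm{pos}(\bar t\upharpoonleft n):n<\omega\}$; $\mathcal A^1_{\bar t}$ is the family of $A\subseteq\mathcal F_{\mathbf H}$ for which there is $N<\omega$ such that every $s\in\Sigma'(\bar t)$ with $\mathrm{nor}[s]\ge N$ and $m^s_{\mathrm{dn}}\ge N$ satisfies $\mathrm{val}[s]\cap A\ne\emptyset$. For $\ell\in\{0,1\}$, $\mathrm{uf}^\ell_{\bar t}(K,\Sigma)$ is the set of ultrafilters $D$ on $\mathcal F_{\mathbf H}$ with $\mathcal A^\ell_{\bar t}\subseteq D$. For $f\in\mathcal F_{\mathbf H}$ and $A\subseteq\mathcal F_{\mathbf H}$: $f\oplus A=\{g\in\mathcal F_{\mathbf H}:\max\mathrm{dom}(f)<\min\mathrm{dom}(g),\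 f\cup g\in A\}$. For ultrafilters $D_1,D_2$ on $\mathcal F_{\mathbf H}$: $D_1\oplus D_2=\{A\subseteq\mathcal F_{\mathbf H}:\{f\in\mathcal F_{\mathbf H}:f\oplus A\in D_1\}\in D_2\}$. *)

theory Defs
  imports Complex_Main "HOL-Library.Countable_Set"
begin

definition FH :: "(nat \<Rightarrow> 'a set) \<Rightarrow> (nat \<rightharpoonup> 'a) set" where
  "FH H = {f. finite (dom f) \<and> dom f \<noteq> {} \<and> (\<forall>i\<in>dom f. the (f i) \<in> H i)}"

record ('a, 'd) creature =
  nor :: real
  val :: "(nat \<rightharpoonup> 'a) set"
  dis :: 'd
  mdn :: nat
  mup :: nat

definition FP_creature :: "(nat \<Rightarrow> 'a set) \<Rightarrow> ('a, 'd) creature \<Rightarrow> bool" where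
  "FP_creature H t \<longleftrightarrow>
     0 \<le> nor t \<and> mdn t < mup t \<and>
     val t \<noteq> {} \<and> finite (val t) \<and> val t \<subseteq> FH H \<and>
     (\<forall>f\<in>val t. dom f \<subseteq> {mdn t..<mup t})"

definition ordered_seqs :: "('a, 'd) creature set \<Rightarrow> ('a, 'd) creature list set" where
  "ordered_seqs K = {ts. ts \<noteq> [] \<and> set ts \<subseteq> K \<and>
     (\<forall>l. Suc l < length ts \<longrightarrow> mup (ts ! l) \<le> mdn (ts ! Suc l))}"

text \<open>
  The partial function \<open>\<Sigma>\<close> is represented by a total function on lists.  Its values on its
  domain are non-empty and it is taken to be empty elsewhere, so the domain is recovered
  as the set of lists with non-empty value.
\<close>

definition Sdom :: "(('a, 'd) creature list \<Rightarrow> ('a, 'd) creature set) \<Rightarrow> ('a, 'd) creature list set"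
  where "Sdom \<Sigma> = {ts. \<Sigma> ts \<noteq> {}}"

locale FFCC_pair =
  fixes H :: "nat \<Rightarrow> 'a set"
    and K :: "('a, 'd) creature set"
    and \<Sigma> :: "('a, 'd) creature list \<Rightarrow> ('a, 'd) creature set"
  assumes countable_K: "countable K"
    and creatures: "\<And>t. t \<in> K \<Longrightarrow> FP_creature H t"
    and finite_below: "\<And>m. finite {t \<in> K. mup t \<le> m}"
    and infinite_above: "\<And>m. infinite {t \<in> K. m \<le> mdn t \<and> real m \<le> nor t}"
    and Sdom_subset: "Sdom \<Sigma> \<subseteq> ordered_seqs K"
    and Sigma_subset: "\<And>ts. ts \<in> Sdom \<Sigma> \<Longrightarrow> \<Sigma> ts \<subseteq> K"
    and Sigma_bounds:
      "\<And>ts t. ts \<in> Sdom \<Sigma> \<Longrightarrow> t \<in> \<Sigma> ts \<Longrightarrow> mdn t = mdn (hd ts) \<and> mup t = mup (last ts)"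
    and Sigma_refl: "\<And>t. t \<in> K \<Longrightarrow> t \<in> \<Sigma> [t]"
    and Sigma_val:
      "\<And>ts t f. ts \<in> Sdom \<Sigma> \<Longrightarrow> t \<in> \<Sigma> ts \<Longrightarrow> f \<in> val t \<Longrightarrow>
         dom f \<subseteq> (\<Union>r\<in>set ts. {mdn r..<mup r}) \<and>
         (\<forall>r\<in>set ts. f |` {mdn r..<mup r} \<in> val r \<union> {Map.empty})"
    and Sigma_concat:
      "\<And>tss ss. tss \<noteq> [] \<Longrightarrow> set tss \<subseteq> Sdom \<Sigma> \<Longrightarrow> concat tss \<in> Sdom \<Sigma> \<Longrightarrow>
         list_all2 (\<lambda>s ts. s \<in> \<Sigma> ts) ss tss \<Longrightarrow> \<Sigma> ss \<subseteq> \<Sigma> (concat tss)"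

locale loose_FFCC_pair = FFCC_pair +
  assumes loose: "Sdom \<Sigma> = ordered_seqs K"

definition PC_inf :: "('a, 'd) creature set \<Rightarrow> (nat \<Rightarrow> ('a, 'd) creature) set" where
  "PC_inf K = {t. range t \<subseteq> K \<and> (\<forall>n. mup (t n) \<le> mdn (t (Suc n))) \<and>
     filterlim (\<lambda>n. nor (t n)) at_top sequentially}"

definition seq_restrict :: "(nat \<Rightarrow> 'b) \<Rightarrow> nat set \<Rightarrow> 'b list" where
  "seq_restrict t u = map t (sorted_list_of_set u)"

definition PC_le ::
  "(('a, 'd) creature list \<Rightarrow> ('a, 'd) creature set) \<Rightarrow>
   (nat \<Rightarrow> ('a, 'd) creature) \<Rightarrow> (nat \<Rightarrow> ('a, 'd) creature) \<Rightarrow> bool" where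
  "PC_le \<Sigma> t s \<longleftrightarrow> (\<exists>u :: nat \<Rightarrow> nat set.
     (\<forall>n. finite (u n) \<and> u n \<noteq> {} \<and> Max (u n) < Min (u (Suc n))) \<and>
     (\<forall>n. s n \<in> \<Sigma> (seq_restrict t (u n))))"

definition Sigma_prime ::
  "(('a, 'd) creature list \<Rightarrow> ('a, 'd) creature set) \<Rightarrow>
   (nat \<Rightarrow> ('a, 'd) creature) \<Rightarrow> ('a, 'd) creature set" where
  "Sigma_prime \<Sigma> t = (\<Union>u\<in>{u. finite u \<and> u \<noteq> {}}. \<Sigma> (seq_restrict t u))"

definition pos ::
  "(('a, 'd) creature list \<Rightarrow> ('a, 'd) creature set) \<Rightarrow>
   (nat \<Rightarrow> ('a, 'd) creature) \<Rightarrow> (nat \<rightharpoonup> 'a) set" where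
  "pos \<Sigma> t = (\<Union>s\<in>Sigma_prime \<Sigma> t. val s)"

text \<open>Ultrafilters on a set, not on a type; principal ones are allowed.\<close>

definition ultrafilter_on :: "'b set \<Rightarrow> 'b set set \<Rightarrow> bool" where
  "ultrafilter_on X D \<longleftrightarrow>
     D \<subseteq> Pow X \<and> X \<in> D \<and> {} \<notin> D \<and>
     (\<forall>A\<in>D. \<forall>B\<in>D. A \<inter> B \<in> D) \<and>
     (\<forall>A\<in>D. \<forall>B. A \<subseteq> B \<and> B \<subseteq> X \<longrightarrow> B \<in> D) \<and>
     (\<forall>A. A \<subseteq> X \<longrightarrow> A \<in> D \<or> X - A \<in> D)"

definition A1 ::
  "(nat \<Rightarrow> 'a set) \<Rightarrow> (('a, 'd) creature list \<Rightarrow> ('a, 'd) creature set) \<Rightarrow>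
   (nat \<Rightarrow> ('a, 'd) creature) \<Rightarrow> (nat \<rightharpoonup> 'a) set set" where
  "A1 H \<Sigma> t = {A. A \<subseteq> FH H \<and>
     (\<exists>N::nat. \<forall>s\<in>Sigma_prime \<Sigma> t. real N \<le> nor s \<and> N \<le> mdn s \<longrightarrow> val s \<inter> A \<noteq> {})}"

definition uf1 ::
  "(nat \<Rightarrow> 'a set) \<Rightarrow> (('a, 'd) creature list \<Rightarrow> ('a, 'd) creature set) \<Rightarrow>
   (nat \<Rightarrow> ('a, 'd) creature) \<Rightarrow> (nat \<rightharpoonup> 'a) set set set" where
  "uf1 H \<Sigma> t = {D. ultrafilter_on (FH H) D \<and> A1 H \<Sigma> t \<subseteq> D}"

text \<open>The domains of \<open>f\<close> and \<open>g\<close> below are disjoint, so \<open>f ++ g\<close> is the union of their graphs.\<close>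

definition fun_oplus ::
  "(nat \<Rightarrow> 'a set) \<Rightarrow> (nat \<rightharpoonup> 'a) \<Rightarrow> (nat \<rightharpoonup> 'a) set \<Rightarrow> (nat \<rightharpoonup> 'a) set" where
  "fun_oplus H f A = {g \<in> FH H. Max (dom f) < Min (dom g) \<and> f ++ g \<in> A}"

definition uf_oplus ::
  "(nat \<Rightarrow> 'a set) \<Rightarrow> (nat \<rightharpoonup> 'a) set set \<Rightarrow> (nat \<rightharpoonup> 'a) set set \<Rightarrow> (nat \<rightharpoonup> 'a) set set" where
  "uf_oplus H D1 D2 = {A. A \<subseteq> FH H \<and> {f \<in> FH H. fun_oplus H f A \<in> D1} \<in> D2}"

end

theory Submission
  imports Defs
begin

text \<open>
  The argument is that of Galvin and Glazer.  Since \<open>D\<close> is idempotent, the set \<open>A'\<close> of those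
  \<open>f \<in> A\<close> with \<open>f \<oplus> A \<in> D\<close> is in \<open>D\<close>, and \<open>f \<oplus> A' \<in> D\<close> for every \<open>f \<in> A'\<close>.  As \<open>D\<close> extends
  \<open>\<A>\<^sup>1\<close>, every member of \<open>D\<close> includes the values of creatures in \<open>\<Sigma>'(t)\<close> of arbitrarily large
  norm lying arbitrarily far out.  So one can choose \<open>s\<^sub>n\<close> recursively with values in
  \<open>A'\<close> and in \<open>f \<oplus> A'\<close> for each \<open>f\<close> in the finite set of unions of values of the
  earlier creatures; all these unions stay in \<open>A'\<close>, and \<open>pos s\<close> consists of such unions.
\<close>

section \<open>Ultrafilters and the operation \<open>fun_oplus\<close>\<close>

lemma ultrafilter_on_Int_INT:
  assumes "ultrafilter_on X D" and "finite F" and "B \<in> D" and "\<And>f. f \<in> F \<Longrightarrow> C f \<in> D"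
  shows "B \<inter> (\<Inter>f\<in>F. C f) \<in> D"
  using assms(2,4)
proof (induction F rule: finite_induct)
  case empty
  then show ?case using assms(3) by simp
next
  case (insert f F)
  then have "C f \<inter> (B \<inter> (\<Inter>f\<in>F. C f)) \<in> D"
    using assms(1) by (simp add: ultrafilter_on_def)
  moreover have "B \<inter> (\<Inter>f\<in>insert f F. C f) = C f \<inter> (B \<inter> (\<Inter>f\<in>F. C f))"
    by auto
  ultimately show ?case by simp
qed

text \<open>\<open>++\<close> is associative, and as \<open>dom f\<close> lies to the left of
  \<open>dom g\<close>, the last point of \<open>dom (f ++ g)\<close> is that of
  \<open>dom g\<close>. So a function that starts after \<open>g\<close> also starts after
  \<open>f ++ g\<close>.\<close>

lemma fun_oplus_fun_oplus_subset:
  assumes f: "f \<in> FH H" and g: "g \<in> FH H" and fg: "Max (dom f) < Min (dom g)"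
  shows "fun_oplus H g (fun_oplus H f A) \<subseteq> fun_oplus H (f ++ g) A"
proof
  fix h assume h: "h \<in> fun_oplus H g (fun_oplus H f A)"
  have fin: "finite (dom f)" "dom f \<noteq> {}" "finite (dom g)" "dom g \<noteq> {}"
    using f g by (auto simp: FH_def)
  have "Max (dom (f ++ g)) = max (Max (dom f)) (Max (dom g))"
    using fin by (simp add: Max_Un max.commute)
  also have "\<dots> = Max (dom g)"
  proof -
    have "Min (dom g) \<le> Max (dom g)" using fin by simp
    then show ?thesis using fg by simp
  qed
  finally show "h \<in> fun_oplus H (f ++ g) A"
    using h by (auto simp: fun_oplus_def)
qed

locale idempotent_ultrafilter =
  fixes H :: "nat \<Rightarrow> 'a set" and D :: "(nat \<rightharpoonup> 'a) set set"
  assumes ultra: "ultrafilter_on (FH H) D" and idem: "uf_oplus H D D = D"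
begin

text \<open>The counterpart of the set {x in A : -x + A in p} from the ultrafilter proof of
  Hindman's theorem.\<close>

definition star :: "(nat \<rightharpoonup> 'a) set \<Rightarrow> (nat \<rightharpoonup> 'a) set" where
  "star A = {f \<in> A. fun_oplus H f A \<in> D}"

lemma D_subset: "A \<in> D \<Longrightarrow> A \<subseteq> FH H"
  using ultra by (auto simp: ultrafilter_on_def)

lemma D_mono: "A \<in> D \<Longrightarrow> A \<subseteq> B \<Longrightarrow> B \<subseteq> FH H \<Longrightarrow> B \<in> D"
  using ultra by (auto simp: ultrafilter_on_def)

text \<open>As \<open>A\<close> lies in \<open>D = uf_oplus H D D\<close>, the second condition
  defining \<open>star A\<close> holds on a set in \<open>D\<close>.\<close>

lemma star_in:
  assumes "A \<in> D"
  shows "star A \<in> D"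
proof -
  have "{f \<in> FH H. fun_oplus H f A \<in> D} \<in> D"
    using assms idem unfolding uf_oplus_def by blast
  then have "A \<inter> {f \<in> FH H. fun_oplus H f A \<in> D} \<in> D"
    using assms ultra unfolding ultrafilter_on_def by blast
  moreover have "A \<inter> {f \<in> FH H. fun_oplus H f A \<in> D} = star A"
    using D_subset[OF assms] by (auto simp: star_def)
  ultimately show ?thesis by simp
qed

text \<open>\<open>fun_oplus H f A\<close> is itself in \<open>D\<close>, hence so is its star; each
  \<open>g\<close> in that star puts \<open>f ++ g\<close> into \<open>star A\<close>.\<close>

lemma fun_oplus_star_in:
  assumes A: "A \<in> D" and f: "f \<in> star A"
  shows "fun_oplus H f (star A) \<in> D"
proof (rule D_mono)
  show "star (fun_oplus H f A) \<in> D"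
    using f by (intro star_in) (simp add: star_def)
  show "fun_oplus H f (star A) \<subseteq> FH H"
    by (auto simp: fun_oplus_def)
  show "star (fun_oplus H f A) \<subseteq> fun_oplus H f (star A)"
  proof
    fix g assume "g \<in> star (fun_oplus H f A)"
    then have g: "g \<in> FH H" "Max (dom f) < Min (dom g)" "f ++ g \<in> A"
      and gD: "fun_oplus H g (fun_oplus H f A) \<in> D"
      by (auto simp: star_def fun_oplus_def)
    have "f \<in> FH H" using f D_subset[OF A] by (auto simp: star_def)
    then have "fun_oplus H (f ++ g) A \<in> D"
      using g by (intro D_mono[OF gD] fun_oplus_fun_oplus_subset) (auto simp: fun_oplus_def)
    then show "g \<in> fun_oplus H f (star A)"
      using g by (simp add: star_def fun_oplus_def)
  qed
qed

end

section \<open>Creatures over finite blocks of a sequence\<close>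

lemma set_seq_restrict: "finite u \<Longrightarrow> set (seq_restrict t u) = t ` u"
  by (simp add: seq_restrict_def)

lemma hd_seq_restrict: "finite u \<Longrightarrow> u \<noteq> {} \<Longrightarrow> hd (seq_restrict t u) = t (Min u)"
  by (simp add: seq_restrict_def hd_map sorted_list_of_set_nonempty)

lemma last_seq_restrict:
  assumes "finite u" "u \<noteq> {}"
  shows "last (seq_restrict t u) = t (Max u)"
proof -
  have Max: "Max u \<in> u" using assms by simp
  have "sorted_list_of_set u = sorted_list_of_set (u - {Max u}) @ [Max u]"
    using assms Max by (intro sorted_distinct_set_unique) (simp_all add: sorted_append insert_absorb)
  then show ?thesis by (simp add: seq_restrict_def)
qed

context FFCC_pair
begin

lemma Sigma_in_K: "s \<in> \<Sigma> ts \<Longrightarrow> s \<in> K"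
  using Sigma_subset[of ts] by (auto simp: Sdom_def)

lemma mdn_Sigma:
  assumes "s \<in> \<Sigma> (seq_restrict t u)" "finite u" "u \<noteq> {}"
  shows "mdn s = mdn (t (Min u))"
proof -
  have "seq_restrict t u \<in> Sdom \<Sigma>" using assms(1) by (auto simp: Sdom_def)
  then show ?thesis using assms by (simp add: Sigma_bounds hd_seq_restrict)
qed

lemma mup_Sigma:
  assumes "s \<in> \<Sigma> (seq_restrict t u)" "finite u" "u \<noteq> {}"
  shows "mup s = mup (t (Max u))"
proof -
  have "seq_restrict t u \<in> Sdom \<Sigma>" using assms(1) by (auto simp: Sdom_def)
  then show ?thesis using assms by (simp add: Sigma_bounds last_seq_restrict)
qed

lemma mdn_less_mup: "s \<in> K \<Longrightarrow> mdn s < mup s"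
  using creatures[of s] by (simp add: FP_creature_def)

lemma val_FH: "s \<in> K \<Longrightarrow> val s \<subseteq> FH H"
  using creatures[of s] by (simp add: FP_creature_def)

lemma finite_val: "s \<in> K \<Longrightarrow> finite (val s)"
  using creatures[of s] by (simp add: FP_creature_def)

lemma PC_inf_mup_le_mdn:
  assumes t: "t \<in> PC_inf K" and "i < j"
  shows "mup (t i) \<le> mdn (t j)"
  using \<open>i < j\<close>
proof (induction j)
  case (Suc j)
  have step: "mup (t j) \<le> mdn (t (Suc j))" and "t j \<in> K"
    using t by (auto simp: PC_inf_def)
  show ?case
  proof (cases "i = j")
    case False
    then have "mup (t i) \<le> mdn (t j)" using Suc by simp
    then show ?thesis using step mdn_less_mup[OF \<open>t j \<in> K\<close>] by simp
  qed (simp add: step)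
qed simp

text \<open>If every creature in \<open>Sigma_prime \<Sigma> t\<close> with large norm and large
  \<open>mdn\<close> had a value outside \<open>C\<close>, the complement of \<open>C\<close> would
  be in \<open>A1 H \<Sigma> t\<close>, hence in \<open>D\<close> together with \<open>C\<close>.
  The parameter \<open>m\<close> lets a new block start after the previous one.\<close>

lemma ex_Sigma_val_subset:
  assumes t: "t \<in> PC_inf K" and D: "D \<in> uf1 H \<Sigma> t" and C: "C \<in> D"
  shows "\<exists>u s. finite u \<and> u \<noteq> {} \<and> m < Min u \<and> s \<in> \<Sigma> (seq_restrict t u) \<and> real n \<le> nor s \<and> val s \<subseteq> C"
proof -
  have ultra: "ultrafilter_on (FH H) D" and A1: "A1 H \<Sigma> t \<subseteq> D"
    using D by (auto simp: uf1_def)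
  have "FH H - C \<notin> D"
  proof
    assume "FH H - C \<in> D"
    then have "C \<inter> (FH H - C) \<in> D" using ultra C unfolding ultrafilter_on_def by blast
    then show False using ultra by (simp add: ultrafilter_on_def)
  qed
  then have "FH H - C \<notin> A1 H \<Sigma> t" using A1 by auto
  \<comment> \<open>The threshold serves two demands: \<open>n\<close> bounds the norm, and
    \<open>mup (t m) \<le> mdn s\<close> keeps the block from starting at an index up to
    \<open>m\<close>.\<close>
  then obtain s where s: "s \<in> Sigma_prime \<Sigma> t" "real (max n (mup (t m))) \<le> nor s"
      "max n (mup (t m)) \<le> mdn s" "val s \<inter> (FH H - C) = {}"
    unfolding A1_def by blast
  from s(1) obtain u where u: "finite u" "u \<noteq> {}" "s \<in> \<Sigma> (seq_restrict t u)"
    by (auto simp: Sigma_prime_def)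
  have tK: "t i \<in> K" for i using t by (auto simp: PC_inf_def)
  have "m < Min u"
  proof (rule ccontr)
    assume "\<not> m < Min u"
    then have "Min u = m \<or> Min u < m" by auto
    then have "mdn (t (Min u)) < mup (t m)"
      using PC_inf_mup_le_mdn[OF t, of "Min u" m] mdn_less_mup[OF tK[of m]]
        mdn_less_mup[OF tK[of "Min u"]] by auto
    then show False using s(3) mdn_Sigma[OF u(3) u(1,2)] by simp
  qed
  moreover have "val s \<subseteq> C" using s(4) val_FH[OF Sigma_in_K[OF u(3)]] by auto
  moreover have "real n \<le> nor s" using s(2) by simp
  ultimately show ?thesis using u by blast
qed

lemma PC_inf_if_blocks:
  assumes t: "t \<in> PC_inf K"
    and u: "\<And>n. finite (u n) \<and> u n \<noteq> {} \<and> Max (u n) < Min (u (Suc n))"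
    and s: "\<And>n. s n \<in> \<Sigma> (seq_restrict t (u n))"
    and nor: "\<And>n. real n \<le> nor (s n)"
  shows "s \<in> PC_inf K"
proof -
  have "mup (s n) \<le> mdn (s (Suc n))" for n
    using PC_inf_mup_le_mdn[OF t, of "Max (u n)" "Min (u (Suc n))"] u
    by (simp add: mup_Sigma[OF s] mdn_Sigma[OF s])
  moreover have "filterlim (\<lambda>n. nor (s n)) at_top sequentially"
    by (rule filterlim_at_top_mono[OF filterlim_real_sequentially]) (simp add: nor)
  ultimately show ?thesis using Sigma_in_K[OF s] by (auto simp: PC_inf_def)
qed

text \<open>By \<open>Sigma_val\<close>, a value of a creature built from finitely many
  \<open>s i\<close> restricts on each of their intervals to a value of \<open>s i\<close> or to the
  empty function. Gluing these pieces from left to right stays within the sets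
  \<open>F n\<close>.\<close>

lemma pos_subset_if_unions:
  fixes F :: "nat \<Rightarrow> (nat \<rightharpoonup> 'a) set"
  assumes val: "\<And>n. val (s n) \<subseteq> F n"
    and mono: "\<And>n. F n \<subseteq> F (Suc n)"
    and union: "\<And>n f g. f \<in> F n \<Longrightarrow> g \<in> val (s (Suc n)) \<Longrightarrow> f ++ g \<in> F (Suc n)"
  shows "pos \<Sigma> s \<subseteq> (\<Union>n. F n)"
proof
  fix f assume "f \<in> pos \<Sigma> s"
  then obtain v r where v: "finite v" "v \<noteq> {}" and r: "r \<in> \<Sigma> (seq_restrict s v)"
    and f: "f \<in> val r"
    by (auto simp: pos_def Sigma_prime_def)
  define I where "I i = {mdn (s i)..<mup (s i)}" for i
  have "seq_restrict s v \<in> Sdom \<Sigma>" using r by (auto simp: Sdom_def)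
  from Sigma_val[OF this r f] v have dom: "dom f \<subseteq> (\<Union>i\<in>v. I i)"
    and "\<forall>i\<in>v. f |` I i \<in> val (s i) \<union> {Map.empty}"
    by (auto simp: set_seq_restrict I_def)
  then have piece: "f |` I i \<in> val (s i) \<union> {Map.empty}" if "i \<in> v" for i
    using that by blast
  \<comment> \<open>An initial part of \<open>f\<close> may be empty although \<open>f\<close> is
    not, so the invariant has to allow \<open>Map.empty\<close>.\<close>
  define h where "h n = f |` (\<Union>i\<in>{i\<in>v. i \<le> n}. I i)" for n
  have h: "h n \<in> F n \<union> {Map.empty}" for n
  proof (induction n)
    case 0
    show ?case
    proof (cases "0 \<in> v")
      case True
      then have *: "{i\<in>v. i \<le> 0} = {0}" by auto
      have "h 0 = f |` I 0" unfolding h_def * by simp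
      then show ?thesis using piece[OF True] val[of 0] by auto
    next
      case False
      then have *: "{i\<in>v. i \<le> 0} = {}" by auto
      have "h 0 = Map.empty" unfolding h_def * by simp
      then show ?thesis by simp
    qed
  next
    case (Suc n)
    show ?case
    proof (cases "Suc n \<in> v")
      case True
      then have *: "{i\<in>v. i \<le> Suc n} = {i\<in>v. i \<le> n} \<union> {Suc n}" by auto
      have "h (Suc n) = h n ++ f |` I (Suc n)"
        unfolding h_def * by (rule ext) (auto simp: restrict_map_def map_add_def split: option.split)
      \<comment> \<open>\<open>union\<close> serves two non-empty pieces, \<open>val\<close> an
        empty \<open>h n\<close>, and \<open>mono\<close> an empty new piece.\<close>
      then show ?thesis
        using Suc piece[OF True] val[of "Suc n"] mono[of n] union[of "h n" n] by auto
    next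
      case False
      then have *: "{i\<in>v. i \<le> Suc n} = {i\<in>v. i \<le> n}" by (auto simp: le_Suc_eq)
      have "h (Suc n) = h n" unfolding h_def * ..
      then show ?thesis using Suc mono[of n] by auto
    qed
  qed
  have *: "{i\<in>v. i \<le> Max v} = v" using v by auto
  have "h (Max v) = f"
  proof
    fix i
    show "h (Max v) i = f i"
      unfolding h_def * using dom by (cases "f i") (auto simp: restrict_map_def)
  qed
  moreover have "f \<noteq> Map.empty"
    using f val_FH[OF Sigma_in_K[OF r]] by (auto simp: FH_def)
  ultimately show "f \<in> (\<Union>n. F n)" using h[of "Max v"] by auto
qed

text \<open>The recursive choice, to be applied with \<open>B = star A\<close>. \<open>F n\<close>
  contains every union of values of \<open>s 0\<close>, ..., \<open>s n\<close> that takes at most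
  one from each and at least one in all.\<close>

lemma ex_block_sequence:
  assumes t: "t \<in> PC_inf K" and D: "D \<in> uf1 H \<Sigma> t" and B: "B \<in> D"
    and oplus: "\<And>f. f \<in> B \<Longrightarrow> fun_oplus H f B \<in> D"
  obtains u s F where
    "\<And>n. finite (u n) \<and> u n \<noteq> {} \<and> Max (u n) < Min (u (Suc n))"
    "\<And>n. s n \<in> \<Sigma> (seq_restrict t (u n))"
    "\<And>n. real n \<le> nor (s n)"
    "\<And>n. val (s n) \<subseteq> F n" "\<And>n. F n \<subseteq> F (Suc n)" "\<And>n. F n \<subseteq> B"
    "\<And>n f g. f \<in> F n \<Longrightarrow> g \<in> val (s (Suc n)) \<Longrightarrow> f ++ g \<in> F (Suc n)"
proof -
  have ultra: "ultrafilter_on (FH H) D" using D by (simp add: uf1_def)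
  \<comment> \<open>\<open>P\<close> constrains a single stage, \<open>Q\<close> two consecutive
    ones. \<open>P\<close> keeps \<open>F\<close> finite because \<open>D\<close> is closed under
    finite intersections.\<close>
  define P where "P n = (\<lambda>(u, s, F). finite u \<and> u \<noteq> {} \<and> s \<in> \<Sigma> (seq_restrict t u) \<and>
    real n \<le> nor s \<and> finite F \<and> F \<subseteq> B \<and> val s \<subseteq> F)" for n
  define Q where "Q = (\<lambda>(u, s :: ('a, 'd) creature, F) (u', s' :: ('a, 'd) creature, F').
    Max (u :: nat set) < Min (u' :: nat set) \<and> F \<subseteq> (F' :: (nat \<rightharpoonup> 'a) set) \<and>
    (\<forall>f\<in>F. \<forall>g\<in>val s'. f ++ g \<in> F'))"
  have "\<exists>x. \<forall>n. P n (x n) \<and> Q (x n) (x (Suc n))"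
  proof (rule dependent_nat_choice)
    obtain u s where us: "finite u" "u \<noteq> {}" "s \<in> \<Sigma> (seq_restrict t u)" "real 0 \<le> nor s" "val s \<subseteq> B"
      using ex_Sigma_val_subset[OF t D B, of 0 0] by blast
    then have "P 0 (u, s, val s)"
      by (simp add: P_def finite_val[OF Sigma_in_K[OF us(3)]])
    then show "\<exists>x. P 0 x" ..
  next
    fix x n assume "P n x"
    moreover obtain u s F where x: "x = (u, s, F)" by (cases x)
    ultimately have F: "finite F" "F \<subseteq> B" by (auto simp: P_def)
    \<comment> \<open>Elements of this set lie in \<open>B\<close> and can be appended to every
      member of \<open>F\<close> without leaving \<open>B\<close>.\<close>
    have "B \<inter> (\<Inter>f\<in>F. fun_oplus H f B) \<in> D"
      using F by (intro ultrafilter_on_Int_INT[OF ultra _ B] oplus) auto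
    from ex_Sigma_val_subset[OF t D this, of "Max u" "Suc n"]
    obtain u' s' where us': "finite u'" "u' \<noteq> {}" "Max u < Min u'" "s' \<in> \<Sigma> (seq_restrict t u')"
      "real (Suc n) \<le> nor s'" and val: "val s' \<subseteq> B \<inter> (\<Inter>f\<in>F. fun_oplus H f B)"
      by blast
    \<comment> \<open>The parts are the unions that skip the new creature, those that use it alone,
      and those that extend an earlier union by it.\<close>
    define F' where "F' = F \<union> val s' \<union> (\<lambda>(f, g). f ++ g) ` (F \<times> val s')"
    have "finite F'" using F finite_val[OF Sigma_in_K[OF us'(4)]] by (simp add: F'_def)
    moreover have "F' \<subseteq> B" using F val by (auto simp: F'_def fun_oplus_def)
    ultimately have "P (Suc n) (u', s', F')" using us' by (auto simp: P_def F'_def)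
    moreover have "Q x (u', s', F')" using us' by (auto simp: Q_def x F'_def)
    ultimately show "\<exists>y. P (Suc n) y \<and> Q x y" by blast
  qed
  then obtain x where x: "\<And>n. P n (x n)" "\<And>n. Q (x n) (x (Suc n))" by blast
  define u where "u n = fst (x n)" for n
  define s where "s n = fst (snd (x n))" for n
  define F where "F n = snd (snd (x n))" for n
  have eq: "x n = (u n, s n, F n)" for n by (simp add: u_def s_def F_def)
  have P: "P n (u n, s n, F n)" for n
    using x(1)[of n] unfolding eq .
  have Q: "Q (u n, s n, F n) (u (Suc n), s (Suc n), F (Suc n))" for n
    using x(2)[of n] unfolding eq .
  show thesis
  proof (rule that)
    fix n
    show "finite (u n) \<and> u n \<noteq> {} \<and> Max (u n) < Min (u (Suc n))"
      and "s n \<in> \<Sigma> (seq_restrict t (u n))" and "real n \<le> nor (s n)"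
      and "val (s n) \<subseteq> F n" and "F n \<subseteq> F (Suc n)" and "F n \<subseteq> B"
      using P[of n, unfolded P_def prod.case] Q[of n, unfolded Q_def prod.case] by blast+
    show "f ++ g \<in> F (Suc n)" if "f \<in> F n" "g \<in> val (s (Suc n))" for f g
      using Q[of n, unfolded Q_def prod.case] that by blast
  qed
qed

end

theorem theorem2p9:
  fixes H :: "nat \<Rightarrow> 'a set"
    and K :: "('a, 'd) creature set"
    and \<Sigma> :: "('a, 'd) creature list \<Rightarrow> ('a, 'd) creature set"
    and t :: "nat \<Rightarrow> ('a, 'd) creature"
    and D :: "(nat \<rightharpoonup> 'a) set set"
  assumes "\<And>i. finite (H i) \<and> H i \<noteq> {}"
    and "loose_FFCC_pair H K \<Sigma>"
    and "t \<in> PC_inf K"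
    and "D \<in> uf1 H \<Sigma> t"
    and "uf_oplus H D D = D"
  shows "\<forall>A\<in>D. \<exists>s\<in>PC_inf K. PC_le \<Sigma> t s \<and> pos \<Sigma> s \<subseteq> A"
proof
  fix A assume A: "A \<in> D"
  interpret loose_FFCC_pair H K \<Sigma> by fact
  interpret idempotent_ultrafilter H D
    using assms(4,5) by unfold_locales (simp_all add: uf1_def)
  show "\<exists>s\<in>PC_inf K. PC_le \<Sigma> t s \<and> pos \<Sigma> s \<subseteq> A"
  \<comment> \<open>The choice runs inside \<open>star A\<close>, since
    \<open>fun_oplus H f (star A)\<close> is in \<open>D\<close> for each of its members
    \<open>f\<close>.\<close>
  proof (rule ex_block_sequence[OF assms(3,4) star_in[OF A] fun_oplus_star_in[OF A]])
    fix u s F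
    assume u: "\<And>n. finite (u n) \<and> u n \<noteq> {} \<and> Max (u n) < Min (u (Suc n))"
      and s: "\<And>n. s n \<in> \<Sigma> (seq_restrict t (u n))" and nor: "\<And>n. real n \<le> nor (s n)"
      and F: "\<And>n. val (s n) \<subseteq> F n" "\<And>n. F n \<subseteq> F (Suc n)"
      and FA: "\<And>n. F n \<subseteq> star A"
      and union: "\<And>n f g. f \<in> F n \<Longrightarrow> g \<in> val (s (Suc n)) \<Longrightarrow> f ++ g \<in> F (Suc n)"
    have "s \<in> PC_inf K" by (rule PC_inf_if_blocks[OF assms(3) u s nor])
    moreover have "PC_le \<Sigma> t s" unfolding PC_le_def using u s by blast
    moreover have "pos \<Sigma> s \<subseteq> (\<Union>n. F n)" 
      using F union by (rule pos_subset_if_unions)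
    moreover have "(\<Union>n. F n) \<subseteq> star A" using FA by blast
    moreover have "star A \<subseteq> A" unfolding star_def by blast
    ultimately show ?thesis by blast
  qed
qed

end
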